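(* For any probability measures $\mu,\nu$ on $\mathbf{T}$ with finite logarithmic energy, $$\mathcal{H}(\mu,\nu)\le\frac12\,\mathcal{I}(\mu,\nu).$$ Equality is attained when $\mu(dz)-\nu(dz)=(a\,\mathrm{Re}(z)+b\,\mathrm{Im}(z))\,\alpha(dz)$ for some $a,b\in\mathbb{R}$.
   Context: $\mathbf{T}$ is the unit circle in $\mathbb{C}$ and $\alpha$ is the normalized (probability) Haar measure on $\mathbf{T}$. A probability measure $\mu$ on $\mathbf{T}$ has finite logarithmic energy if $\iint\log|z-w|\,\mu(dz)\mu(dw)>-\infty$. For two probability measures with finite logarithmic energy, $\mathcal{H}(\mu,\nu)=-\iint\log|z-w|\,(\mu-\nu)(dz)(\mu-\nu)(dw)$. For two probability measures $\mu,\nu$ on $\mathbf{T}$, $\mathcal{I}(\mu,\nu)=\int\big(\frac{d\mu}{d\alpha}-\frac{d\nu}{d\alpha}\big)^{2}d\alpha$ if $\mu,\nu$ are absolutely continuous with respect to $\alpha$ with $\frac{d\mu}{d\alpha},\frac{d\nu}{d\alpha}\in L^{2}(\alpha)$, and $\mathcal{I}(\mu,\nu)=+\infty$ otherwise.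
   Formalization: The equality clause is stated only when I(μ,ν) is finite (both measures have densities in L²(α)); otherwise it fails, e.g. for μ=ν with finite logarithmic energy but no L² density, where H=0 and I=+∞. *)

theory Defs
  imports "HOL-Probability.Probability"
begin

definition circle_space :: "complex measure" where
  "circle_space = restrict_space borel (sphere 0 1)"

definition circle_prob :: "complex measure \<Rightarrow> bool" where
  "circle_prob \<mu> \<longleftrightarrow> prob_space \<mu> \<and> sets \<mu> = sets circle_space"

text \<open>Normalized arc length. The lemmas \<open>circle_haar_invariant\<close> and \<open>circle_haar_unique\<close>
  below show that it is the one rotation-invariant probability measure on the circle.\<close>

definition circle_haar :: "complex measure" where
  "circle_haar = distr (uniform_measure lborel {0..<2 * pi}) circle_space cis"

text \<open>The library function \<^const>\<open>ln\<close> satisfies \<open>ln 0 = 0\<close>, so the kernel \<open>log |z - w|\<close>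
  needs its value \<open>-\<infinity>\<close> on the diagonal to be set by hand; otherwise atoms would have
  finite energy.\<close>

definition log_kernel :: "complex \<Rightarrow> complex \<Rightarrow> ereal" where
  "log_kernel z w = (if z = w then -\<infinity> else ereal (ln (cmod (z - w))))"

text \<open>The double integral of \<open>log |z - w|\<close> against \<open>\<mu>(dz) \<nu>(dw)\<close>, as the integral of the positive
  part minus that of the negative part (\<^const>\<open>e2ennreal\<close> sends negative numbers to 0). On the
  circle the positive part is at most \<open>ln 2\<close>, so the difference is never \<open>\<infinity> - \<infinity>\<close>.\<close>

definition log_integral :: "complex measure \<Rightarrow> complex measure \<Rightarrow> ereal" where
  "log_integral \<mu> \<nu> =
     enn2ereal (\<integral>\<^sup>+ (z, w). e2ennreal (log_kernel z w) \<partial>(\<mu> \<Otimes>\<^sub>M \<nu>)) -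
     enn2ereal (\<integral>\<^sup>+ (z, w). e2ennreal (- log_kernel z w) \<partial>(\<mu> \<Otimes>\<^sub>M \<nu>))"

definition finite_log_energy :: "complex measure \<Rightarrow> bool" where
  "finite_log_energy \<mu> \<longleftrightarrow> log_integral \<mu> \<mu> > -\<infinity>"

text \<open>The integral against the signed measure \<open>(\<mu> - \<nu>)(dz) (\<mu> - \<nu>)(dw)\<close>, expanded bilinearly.\<close>

definition log_energy_distance :: "complex measure \<Rightarrow> complex measure \<Rightarrow> ereal" where
  "log_energy_distance \<mu> \<nu> =
     - ((log_integral \<mu> \<mu> - log_integral \<mu> \<nu>) - (log_integral \<nu> \<mu> - log_integral \<nu> \<nu>))"

definition has_L2_density :: "complex measure \<Rightarrow> bool" where
  "has_L2_density \<mu> \<longleftrightarrow> absolutely_continuous circle_haar \<mu> \<and>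
     (\<integral>\<^sup>+ z. (RN_deriv circle_haar \<mu> z)\<^sup>2 \<partial>circle_haar) < \<infinity>"

definition L2_density_distance :: "complex measure \<Rightarrow> complex measure \<Rightarrow> ereal" where
  "L2_density_distance \<mu> \<nu> =
     (if has_L2_density \<mu> \<and> has_L2_density \<nu>
      then ereal (\<integral> z. (enn2real (RN_deriv circle_haar \<mu> z) -
                          enn2real (RN_deriv circle_haar \<nu> z))\<^sup>2 \<partial>circle_haar)
      else \<infinity>)"

lemma space_circle_space: "space circle_space = sphere 0 1"
  by (simp add: circle_space_def space_restrict_space)

lemma measurable_cis_circle [measurable]: "cis \<in> measurable borel circle_space"
  unfolding circle_space_def
  by (intro measurable_restrict_space2 borel_measurable_continuous_onI)
     (auto intro!: continuous_intros)

lemma circle_prob_haar: "circle_prob circle_haar"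
proof -
  have "prob_space (uniform_measure lborel {0..<2 * pi})"
    by (rule prob_space_uniform_measure) auto
  then show ?thesis
    unfolding circle_prob_def circle_haar_def
    by (auto intro!: prob_space.prob_space_distr)
qed

lemma measurable_circle_mult:
  assumes "circle_prob \<mu>" "circle_prob \<nu>"
  shows "(\<lambda>(z, w). z * w) \<in> measurable (\<mu> \<Otimes>\<^sub>M \<nu>) circle_space"
proof -
  have s: "sets (\<mu> \<Otimes>\<^sub>M \<nu>) = sets (circle_space \<Otimes>\<^sub>M circle_space)"
    using assms by (auto simp: circle_prob_def intro!: sets_pair_measure_cong)
  have i: "(\<lambda>z. z) \<in> measurable circle_space (borel :: complex measure)"
    unfolding circle_space_def by (rule measurable_restrict_space1) simp
  have m: "(\<lambda>(z, w). z * w) \<in> measurable (circle_space \<Otimes>\<^sub>M circle_space) (borel :: complex measure)"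
    unfolding split_beta
    by (intro borel_measurable_times measurable_compose[OF measurable_fst i]
        measurable_compose[OF measurable_snd i])
  have "(\<lambda>(z, w). z * w) \<in> measurable (circle_space \<Otimes>\<^sub>M circle_space) circle_space"
    apply (subst (3) circle_space_def)
    apply (rule measurable_restrict_space2[OF _ m])
    apply (auto simp: space_pair_measure space_circle_space norm_mult)
    done
  then show ?thesis
    using measurable_cong_sets[OF s refl] by blast
qed

lemma measurable_circle_rotate:
  assumes "circle_prob \<mu>" "c \<in> sphere 0 1"
  shows "(\<lambda>z. c * z) \<in> measurable \<mu> circle_space"
proof -
  have "(\<lambda>z. (c, z)) \<in> measurable \<mu> (circle_haar \<Otimes>\<^sub>M \<mu>)"
    using assms(2) circle_prob_haar sets_eq_imp_space_eq[of circle_haar circle_space]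
    by (intro measurable_Pair measurable_const)
       (auto simp: circle_prob_def space_circle_space)
  from measurable_compose[OF this measurable_circle_mult[OF circle_prob_haar assms(1)]]
  show ?thesis by simp
qed

lemma emeasure_circle_haar:
  assumes "A \<in> sets circle_space"
  shows "emeasure circle_haar A = emeasure lborel ({0..<2 * pi} \<inter> cis -` A) / (2 * pi)"
proof -
  have "cis -` A \<in> sets lborel"
    using measurable_sets[OF measurable_cis_circle assms] by simp
  then show ?thesis
    using assms by (simp add: circle_haar_def emeasure_distr ennreal_mult)
qed

lemma emeasure_lborel_shift:
  assumes "B \<in> sets borel"
  shows "emeasure lborel ((\<lambda>x. t + x) -` B) = emeasure lborel (B :: real set)"
proof -
  have "emeasure lborel B = emeasure (distr lborel borel ((+) t)) B"
    by (simp add: lborel_distr_plus)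
  also have "\<dots> = emeasure lborel ((+) t -` B)"
    using assms by (subst emeasure_distr) auto
  finally show ?thesis by simp
qed

lemma emeasure_periodic_shift:
  assumes B [measurable]: "B \<in> sets borel" and t: "0 \<le> t" "t \<le> p"
    and per: "\<And>x. x + p \<in> B \<longleftrightarrow> x \<in> B"
  shows "emeasure lborel ({0..<p} \<inter> (\<lambda>x. t + x) -` B) = emeasure lborel ({0..<p::real} \<inter> B)"
proof -
  have "{0..<p} \<inter> (\<lambda>x. t + x) -` B = (\<lambda>x. t + x) -` ({t..<t + p} \<inter> B)"
    by auto
  then have "emeasure lborel ({0..<p} \<inter> (\<lambda>x. t + x) -` B) = emeasure lborel ({t..<t + p} \<inter> B)"
    using emeasure_lborel_shift[of "{t..<t + p} \<inter> B" t] by simp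
  also have "{t..<t + p} \<inter> B = ({t..<p} \<inter> B) \<union> ({p..<t + p} \<inter> B)"
    using t by auto
  also have "emeasure lborel \<dots> = emeasure lborel ({t..<p} \<inter> B) + emeasure lborel ({p..<t + p} \<inter> B)"
    by (rule plus_emeasure[symmetric]) auto
  also have "emeasure lborel ({p..<t + p} \<inter> B) = emeasure lborel ((\<lambda>x. p + x) -` ({p..<t + p} \<inter> B))"
    by (rule emeasure_lborel_shift[symmetric]) auto
  also have "(\<lambda>x. p + x) -` ({p..<t + p} \<inter> B) = {0..<t} \<inter> B"
    using per by (auto simp: add.commute)
  also have "emeasure lborel ({t..<p} \<inter> B) + emeasure lborel ({0..<t} \<inter> B) =
      emeasure lborel (({t..<p} \<inter> B) \<union> ({0..<t} \<inter> B))"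
    by (rule plus_emeasure) auto
  also have "({t..<p} \<inter> B) \<union> ({0..<t} \<inter> B) = {0..<p} \<inter> B"
    using t by auto
  finally show ?thesis .
qed

lemma circle_haar_invariant:
  assumes "c \<in> sphere 0 1"
  shows "distr circle_haar circle_space (\<lambda>z. c * z) = circle_haar"
proof (rule measure_eqI)
  show "sets (distr circle_haar circle_space (\<lambda>z. c * z)) = sets circle_haar"
    by (simp add: circle_haar_def)
next
  fix A assume "A \<in> sets (distr circle_haar circle_space (\<lambda>z. c * z))"
  then have A: "A \<in> sets circle_space" by simp
  obtain t where t: "0 \<le> t" "t < 2 * pi" and c: "c = cis t"
  proof -
    have "c = cis (Arg2pi c)"
      using assms complex_eq_iff Arg2pi[of c] by (simp add: cis_conv_exp is_Arg_def)
    then show ?thesis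
      using that Arg2pi_ge_0 Arg2pi_lt_2pi by blast
  qed
  have m: "(\<lambda>z. c * z) \<in> measurable circle_haar circle_space"
    by (rule measurable_circle_rotate[OF circle_prob_haar assms])
  have sp: "space circle_haar = sphere 0 1"
    by (simp add: circle_haar_def space_circle_space)
  let ?B = "cis -` A"
  have B: "?B \<in> sets borel"
    using measurable_sets[OF measurable_cis_circle A] by simp
  have A': "(\<lambda>z. c * z) -` A \<inter> sphere 0 1 \<in> sets circle_space"
    using measurable_sets[OF m A] by (simp add: sp) (simp add: circle_haar_def)
  have "emeasure (distr circle_haar circle_space (\<lambda>z. c * z)) A =
      emeasure circle_haar ((\<lambda>z. c * z) -` A \<inter> sphere 0 1)"
    using A m by (simp add: emeasure_distr sp)
  also have "\<dots> = emeasure lborel ({0..<2 * pi} \<inter> cis -` ((\<lambda>z. c * z) -` A \<inter> sphere 0 1)) / (2 * pi)"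
    by (rule emeasure_circle_haar[OF A'])
  also have "cis -` ((\<lambda>z. c * z) -` A \<inter> sphere 0 1) = (\<lambda>x. t + x) -` ?B"
    by (auto simp: c cis_mult)
  also have "emeasure lborel ({0..<2 * pi} \<inter> \<dots>) = emeasure lborel ({0..<2 * pi} \<inter> ?B)"
    by (rule emeasure_periodic_shift[OF B]) (use t in \<open>auto simp flip: cis_mult\<close>)
  also have "\<dots> / (2 * pi) = emeasure circle_haar A"
    by (rule emeasure_circle_haar[OF A, symmetric])
  finally show "emeasure (distr circle_haar circle_space (\<lambda>z. c * z)) A = emeasure circle_haar A" .
qed

lemma distr_mult_invariant:
  assumes \<mu>: "circle_prob \<mu>" and \<nu>: "circle_prob \<nu>"
    and inv: "\<And>c. c \<in> sphere 0 1 \<Longrightarrow> distr \<nu> circle_space (\<lambda>z. c * z) = \<nu>"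
  shows "distr (\<mu> \<Otimes>\<^sub>M \<nu>) circle_space (\<lambda>(z, w). z * w) = \<nu>"
proof (rule measure_eqI)
  show "sets (distr (\<mu> \<Otimes>\<^sub>M \<nu>) circle_space (\<lambda>(z, w). z * w)) = sets \<nu>"
    using \<nu> by (simp add: circle_prob_def)
next
  fix A assume "A \<in> sets (distr (\<mu> \<Otimes>\<^sub>M \<nu>) circle_space (\<lambda>(z, w). z * w))"
  then have A: "A \<in> sets circle_space" by simp
  interpret M: prob_space \<mu> using \<mu> by (simp add: circle_prob_def)
  interpret N: prob_space \<nu> using \<nu> by (simp add: circle_prob_def)
  have sp: "space \<mu> = sphere 0 1" "space \<nu> = sphere 0 1"
    using \<mu> \<nu> sets_eq_imp_space_eq by (auto simp: circle_prob_def simp flip: space_circle_space)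
  note m = measurable_circle_mult[OF \<mu> \<nu>]
  let ?P = "(\<lambda>(z, w). z * w) -` A \<inter> space (\<mu> \<Otimes>\<^sub>M \<nu>)"
  have P: "?P \<in> sets (\<mu> \<Otimes>\<^sub>M \<nu>)" by (rule measurable_sets[OF m A])
  have slice: "emeasure \<nu> (Pair z -` ?P) = emeasure \<nu> A" if z: "z \<in> space \<mu>" for z
  proof -
    have "Pair z -` ?P = (\<lambda>w. z * w) -` A \<inter> space \<nu>"
      using z by (auto simp: space_pair_measure)
    moreover have "emeasure (distr \<nu> circle_space (\<lambda>w. z * w)) A = emeasure \<nu> ((\<lambda>w. z * w) -` A \<inter> space \<nu>)"
      using z by (intro emeasure_distr measurable_circle_rotate[OF \<nu>] A) (simp add: sp)
    ultimately show ?thesis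
      using inv z by (simp add: sp)
  qed
  have "emeasure (distr (\<mu> \<Otimes>\<^sub>M \<nu>) circle_space (\<lambda>(z, w). z * w)) A = emeasure (\<mu> \<Otimes>\<^sub>M \<nu>) ?P"
    by (rule emeasure_distr[OF m A])
  also have "\<dots> = (\<integral>\<^sup>+ z. emeasure \<nu> (Pair z -` ?P) \<partial>\<mu>)"
    by (rule N.emeasure_pair_measure_alt[OF P])
  also have "\<dots> = (\<integral>\<^sup>+ z. emeasure \<nu> A \<partial>\<mu>)"
    by (rule nn_integral_cong) (rule slice)
  also have "\<dots> = emeasure \<nu> A"
    by (simp add: M.emeasure_space_1)
  finally show "emeasure (distr (\<mu> \<Otimes>\<^sub>M \<nu>) circle_space (\<lambda>(z, w). z * w)) A = emeasure \<nu> A" .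
qed

lemma circle_haar_unique:
  assumes \<mu>: "circle_prob \<mu>"
    and inv: "\<And>c. c \<in> sphere 0 1 \<Longrightarrow> distr \<mu> circle_space (\<lambda>z. c * z) = \<mu>"
  shows "\<mu> = circle_haar"
proof -
  interpret M: prob_space \<mu> using \<mu> by (simp add: circle_prob_def)
  interpret H: prob_space circle_haar using circle_prob_haar by (simp add: circle_prob_def)
  interpret pair_sigma_finite circle_haar \<mu> ..
  note m = measurable_circle_mult[OF circle_prob_haar \<mu>]
  have "\<mu> = distr (circle_haar \<Otimes>\<^sub>M \<mu>) circle_space (\<lambda>(z, w). z * w)"
    by (rule distr_mult_invariant[OF circle_prob_haar \<mu> inv, symmetric])
  also have "\<dots> = distr (distr (\<mu> \<Otimes>\<^sub>M circle_haar) (circle_haar \<Otimes>\<^sub>M \<mu>) (\<lambda>(x, y). (y, x)))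
      circle_space (\<lambda>(z, w). z * w)"
    using distr_pair_swap by simp
  also have "\<dots> = distr (\<mu> \<Otimes>\<^sub>M circle_haar) circle_space (\<lambda>(z, w). z * w)"
    by (subst distr_distr[OF m measurable_pair_swap'])
       (simp add: o_def case_prod_unfold mult.commute[of "snd _"])
  also have "\<dots> = circle_haar"
    by (rule distr_mult_invariant[OF \<mu> circle_prob_haar circle_haar_invariant])
  finally show ?thesis .
qed

end

theory Submission
  imports Defs
begin

text \<open>Only square-integrable densities matter, since otherwise the right-hand side is infinite. For
  a real \<open>h \<in> L\<^sup>2\<close> with cosine and sine coefficients \<open>a\<^sub>k, b\<^sub>k\<close>, the energy of \<open>h\<close> for the kernel
  \<open>-ln \<bar>1 - r z cnj w\<bar>\<close> with \<open>r < 1\<close> is \<open>\<Sum>k\<ge>1. r\<^sup>k (a\<^sub>k\<^sup>2 + b\<^sub>k\<^sup>2) / k\<close>, which is at most the energy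
  \<open>(a\<^sub>0\<^sup>2 + b\<^sub>0\<^sup>2) / 2 + \<Sum>k\<ge>1. r\<^sup>k (a\<^sub>k\<^sup>2 + b\<^sub>k\<^sup>2)\<close> of \<open>h\<close> for half the Poisson kernel. As that kernel is
  nonnegative with mean \<open>1/2\<close>, the bound \<open>2 h(z) h(w) \<le> h(z)\<^sup>2 + h(w)\<^sup>2\<close> shows that the latter
  is at most \<open>\<integral>h\<^sup>2 / 2\<close>. Letting \<open>r\<close> tend to 1 gives the inequality; if only the first coefficients are
  nonzero, nothing is lost in the limit.\<close>

section \<open>Haar measure and trigonometric coefficients\<close>

interpretation haar: prob_space circle_haar
  using circle_prob_haar by (simp add: circle_prob_def)

interpretation haar2: pair_prob_space circle_haar circle_haar ..

lemma sets_circle_haar: "sets circle_haar = sets circle_space"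
  using circle_prob_haar by (simp add: circle_prob_def)

lemma space_circle_haar: "space circle_haar = sphere 0 1"
  using sets_eq_imp_space_eq[OF sets_circle_haar] by (simp add: space_circle_space)

abbreviation haar2 :: "(complex \<times> complex) measure" where
  "haar2 \<equiv> circle_haar \<Otimes>\<^sub>M circle_haar"

lemma measurable_circle_id: "(\<lambda>z. z) \<in> borel_measurable circle_haar"
proof -
  have "(\<lambda>z. z) \<in> measurable circle_space borel"
    unfolding circle_space_def by (rule measurable_restrict_space1) simp
  then show ?thesis
    using measurable_cong_sets[OF sets_circle_haar refl] by blast
qed

lemma measurable_haar_continuous:
  fixes f :: "complex \<Rightarrow> 'b::topological_space"
  assumes "continuous_on UNIV f"
  shows "f \<in> borel_measurable circle_haar"
  using measurable_compose[OF measurable_circle_id borel_measurable_continuous_onI[OF assms]] .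

lemma measurable_circle_fst [measurable]: "fst \<in> borel_measurable haar2"
  by (rule measurable_compose[OF measurable_fst measurable_circle_id])

lemma measurable_circle_snd [measurable]: "snd \<in> borel_measurable haar2"
  by (rule measurable_compose[OF measurable_snd measurable_circle_id])

lemma norm_space_haar2:
  assumes "p \<in> space haar2"
  shows "cmod (fst p) = 1" "cmod (snd p) = 1"
  using assms by (auto simp: space_pair_measure space_circle_haar)

lemma integrable_haar_bounded_mult:
  fixes f g :: "complex \<Rightarrow> real"
  assumes f: "integrable circle_haar f" and [measurable]: "g \<in> borel_measurable circle_haar"
    and b: "\<And>z. cmod z = 1 \<Longrightarrow> \<bar>g z\<bar> \<le> 1"
  shows "integrable circle_haar (\<lambda>z. f z * g z)"
proof (rule Bochner_Integration.integrable_bound[OF f])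
  show "(\<lambda>z. f z * g z) \<in> borel_measurable circle_haar" using f by measurable
  show "AE z in circle_haar. norm (f z * g z) \<le> norm (f z)"
    by (rule AE_I2) (use b in \<open>auto simp: space_circle_haar abs_mult mult_left_le\<close>)
qed

lemma measurable_Re_power [measurable]: "(\<lambda>z. Re (z ^ k)) \<in> borel_measurable circle_haar"
  by (intro measurable_haar_continuous continuous_intros)

lemma measurable_Im_power [measurable]: "(\<lambda>z. Im (z ^ k)) \<in> borel_measurable circle_haar"
  by (intro measurable_haar_continuous continuous_intros)

lemma Re_power_le: "cmod z = 1 \<Longrightarrow> \<bar>Re (z ^ k)\<bar> \<le> 1"
  using abs_Re_le_cmod[of "z ^ k"] by (simp add: norm_power)

lemma Im_power_le: "cmod z = 1 \<Longrightarrow> \<bar>Im (z ^ k)\<bar> \<le> 1"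
  using abs_Im_le_cmod[of "z ^ k"] by (simp add: norm_power)

lemma integrable_haar_power: "integrable circle_haar (\<lambda>z. z ^ k)"
proof (rule haar.integrable_const_bound[where B = 1])
  show "(\<lambda>z. z ^ k) \<in> borel_measurable circle_haar"
    by (intro measurable_haar_continuous continuous_intros)
qed (auto intro!: AE_I2 simp: space_circle_haar norm_power)

text \<open>Rotation by \<open>cis (pi / k)\<close> preserves Haar measure and multiplies
  \<open>z ^ k\<close> by -1, so the integral equals its own negative.\<close>

lemma integral_haar_power:
  assumes "k > 0"
  shows "(\<integral>z. z ^ k \<partial>circle_haar) = 0"
proof -
  define c where "c = cis (pi / k)"
  have ck: "c ^ k = -1"
    unfolding c_def Complex.DeMoivre using assms by simp
  have m: "(\<lambda>z. z ^ k) \<in> borel_measurable circle_space"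
    using borel_measurable_integrable[OF integrable_haar_power, of k]
    by (simp cong: measurable_cong_sets add: sets_circle_haar)
  have "(\<integral>z. z ^ k \<partial>circle_haar) = (\<integral>z. z ^ k \<partial>distr circle_haar circle_space (\<lambda>z. c * z))"
    by (subst circle_haar_invariant) (auto simp: c_def)
  also have "\<dots> = (\<integral>z. (c * z) ^ k \<partial>circle_haar)"
    by (rule integral_distr[OF measurable_circle_rotate[OF circle_prob_haar] m]) (simp add: c_def)
  also have "\<dots> = - (\<integral>z. z ^ k \<partial>circle_haar)"
    by (simp add: power_mult_distrib ck)
  finally show ?thesis by simp
qed

lemma integral_haar_Re_power: "k > 0 \<Longrightarrow> (\<integral>z. Re (z ^ k) \<partial>circle_haar) = 0"
  and integral_haar_Im_power: "k > 0 \<Longrightarrow> (\<integral>z. Im (z ^ k) \<partial>circle_haar) = 0"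
  by (simp_all add: integral_haar_power integral_Re integral_Im integrable_haar_power)

text \<open>With \<open>z = cis t\<close>, this and \<open>haar_sin\<close> integrate
  \<open>f\<close> against cos (k t) and sin (k t), without the factor 2 of the usual Fourier
  coefficients.\<close>

definition haar_cos :: "(complex \<Rightarrow> real) \<Rightarrow> nat \<Rightarrow> real" where
  "haar_cos f k = (\<integral>z. f z * Re (z ^ k) \<partial>circle_haar)"

definition haar_sin :: "(complex \<Rightarrow> real) \<Rightarrow> nat \<Rightarrow> real" where
  "haar_sin f k = (\<integral>z. f z * Im (z ^ k) \<partial>circle_haar)"

text \<open>By the addition formula for the cosine this is the integral of
  \<open>f z * g w * Re ((z * cnj w) ^ k)\<close> over pairs, the contribution of order k to the
  energy of a rotation-invariant kernel.\<close>

definition coeff_product :: "(complex \<Rightarrow> real) \<Rightarrow> (complex \<Rightarrow> real) \<Rightarrow> nat \<Rightarrow> real" where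
  "coeff_product f g k = haar_cos f k * haar_cos g k + haar_sin f k * haar_sin g k"

lemma coeff_product_0:
  "coeff_product f g 0 = (\<integral>z. f z \<partial>circle_haar) * (\<integral>z. g z \<partial>circle_haar)"
  by (simp add: coeff_product_def haar_cos_def haar_sin_def)

text \<open>The constant function is orthogonal to all harmonics of positive order. Thus integrals
  of a kernel against \<open>f(z)^2\<close> or \<open>g(w)^2\<close> alone involve only the constant
  term of its expansion.\<close>

lemma coeff_product_1_left: "k > 0 \<Longrightarrow> coeff_product (\<lambda>_. 1) g k = 0"
  and coeff_product_1_right: "k > 0 \<Longrightarrow> coeff_product f (\<lambda>_. 1) k = 0"
  by (simp_all add: coeff_product_def haar_cos_def haar_sin_def
      integral_haar_Re_power integral_haar_Im_power)

lemma
  fixes f g :: "complex \<Rightarrow> real"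
  assumes f: "integrable circle_haar f" and g: "integrable circle_haar g"
  shows integrable_tensor: "integrable haar2 (\<lambda>p. f (fst p) * g (snd p))"
    and integral_tensor: "(\<integral>p. f (fst p) * g (snd p) \<partial>haar2) =
      (\<integral>z. f z \<partial>circle_haar) * (\<integral>z. g z \<partial>circle_haar)"
proof -
  have [measurable]: "f \<in> borel_measurable circle_haar" "g \<in> borel_measurable circle_haar"
    using f g by auto
  show i: "integrable haar2 (\<lambda>p. f (fst p) * g (snd p))"
    by (rule haar2.Fubini_integrable) (use f g in \<open>auto simp: abs_mult\<close>)
  show "(\<integral>p. f (fst p) * g (snd p) \<partial>haar2) =
      (\<integral>z. f z \<partial>circle_haar) * (\<integral>z. g z \<partial>circle_haar)"
    using haar2.integral_fst'[OF i] by simp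
qed

section \<open>Kernels with a cosine expansion\<close>

text \<open>Termwise integration. The addition formula splits each term into two tensor products,
  and |c k| |f(z) g(w)| dominates it; this bound is summable both pointwise and after integration,
  so sum and integral may be exchanged.\<close>

lemma
  fixes f g :: "complex \<Rightarrow> real" and K :: "complex \<Rightarrow> complex \<Rightarrow> real" and c :: "nat \<Rightarrow> real"
  assumes f: "integrable circle_haar f" and g: "integrable circle_haar g"
    and c: "summable (\<lambda>k. \<bar>c k\<bar>)"
    and K: "\<And>z w. cmod z = 1 \<Longrightarrow> cmod w = 1 \<Longrightarrow> (\<lambda>k. c k * Re ((z * cnj w) ^ k)) sums K z w"
  shows integrable_cosine_kernel:
      "integrable haar2 (\<lambda>p. K (fst p) (snd p) * (f (fst p) * g (snd p)))"
    and cosine_kernel_sums: "(\<lambda>k. c k * coeff_product f g k) sums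
      (\<integral>p. K (fst p) (snd p) * (f (fst p) * g (snd p)) \<partial>haar2)"
proof -
  define t where "t k p = c k * Re ((fst p * cnj (snd p)) ^ k) * (f (fst p) * g (snd p))"
    for k and p :: "complex \<times> complex"
  have split: "t k p = c k * ((f (fst p) * Re (fst p ^ k)) * (g (snd p) * Re (snd p ^ k))) +
      c k * ((f (fst p) * Im (fst p ^ k)) * (g (snd p) * Im (snd p ^ k)))" for k p
    by (simp add: t_def power_mult_distrib algebra_simps flip: complex_cnj_power)
  note coeff_int = integrable_haar_bounded_mult[OF f measurable_Re_power Re_power_le]
    integrable_haar_bounded_mult[OF f measurable_Im_power Im_power_le]
    integrable_haar_bounded_mult[OF g measurable_Re_power Re_power_le]
    integrable_haar_bounded_mult[OF g measurable_Im_power Im_power_le]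
  note tens = integrable_tensor[OF coeff_int(1,3)] integrable_tensor[OF coeff_int(2,4)]
  have ti: "integrable haar2 (t k)" for k
    unfolding split by (intro Bochner_Integration.integrable_add integrable_mult_right tens)
  have tint: "(\<integral>p. t k p \<partial>haar2) = c k * coeff_product f g k" for k
    unfolding split using tens[THEN integrable_mult_right, of "c k"]
    by (subst Bochner_Integration.integral_add)
       (simp_all add: integral_tensor[OF coeff_int(1,3)] integral_tensor[OF coeff_int(2,4)]
         coeff_product_def haar_cos_def haar_sin_def distrib_left)
  have tb: "norm (t k p) \<le> \<bar>c k\<bar> * \<bar>f (fst p) * g (snd p)\<bar>" if "p \<in> space haar2" for k p
  proof -
    have "\<bar>Re ((fst p * cnj (snd p)) ^ k)\<bar> \<le> 1"
      by (rule Re_power_le) (simp add: norm_mult norm_space_haar2[OF that])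
    then show ?thesis
      by (simp add: t_def abs_mult mult_left_le mult_right_mono)
  qed
  have ab: "integrable haar2 (\<lambda>p. \<bar>f (fst p) * g (snd p)\<bar>)"
    using integrable_tensor[OF f g] by simp
  have s1: "AE p in haar2. summable (\<lambda>k. norm (t k p))"
  proof (rule AE_I2)
    fix p assume "p \<in> space haar2"
    from tb[OF this] show "summable (\<lambda>k. norm (t k p))"
      by (intro summable_comparison_test[OF _ summable_mult2[OF c, of "\<bar>f (fst p) * g (snd p)\<bar>"]]) auto
  qed
  have s2: "summable (\<lambda>k. \<integral>p. norm (t k p) \<partial>haar2)"
  proof (rule summable_comparison_test[OF _ summable_mult2[OF c, of "\<integral>p. \<bar>f (fst p) * g (snd p)\<bar> \<partial>haar2"]],
      intro exI allI impI)
    fix k :: nat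
    have "(\<integral>p. norm (t k p) \<partial>haar2) \<le> (\<integral>p. \<bar>c k\<bar> * \<bar>f (fst p) * g (snd p)\<bar> \<partial>haar2)"
      using ti ab tb by (intro integral_mono) auto
    then show "norm (\<integral>p. norm (t k p) \<partial>haar2) \<le> \<bar>c k\<bar> * (\<integral>p. \<bar>f (fst p) * g (snd p)\<bar> \<partial>haar2)"
      by simp
  qed
  have sum: "(\<Sum>k. t k p) = K (fst p) (snd p) * (f (fst p) * g (snd p))" if "p \<in> space haar2" for p
    using sums_mult2[OF K[OF norm_space_haar2[OF that]], of "f (fst p) * g (snd p)"]
    unfolding t_def by (rule sums_unique[symmetric])
  show "integrable haar2 (\<lambda>p. K (fst p) (snd p) * (f (fst p) * g (snd p)))"
    using integrable_suminf[OF ti s1 s2] by (simp add: sum cong: Bochner_Integration.integrable_cong)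
  show "(\<lambda>k. c k * coeff_product f g k) sums
      (\<integral>p. K (fst p) (snd p) * (f (fst p) * g (snd p)) \<partial>haar2)"
    using sums_integral[OF ti s1 s2] by (simp add: sum tint cong: Bochner_Integration.integral_cong)
qed

text \<open>Real part of the power series of -Ln (1 - x) at \<open>x = r * (z * cnj w)\<close>,
  where |x| = r < 1. The term at k = 0 is 0 because division by zero gives 0.\<close>

lemma log_kernel_series:
  assumes "0 \<le> r" "r < 1" "cmod z = 1" "cmod w = 1"
  shows "(\<lambda>k. r ^ k / k * Re ((z * cnj w) ^ k)) sums (- ln (cmod (1 - r * (z * cnj w))))"
proof -
  let ?x = "of_real r * (z * cnj w)"
  have x: "cmod ?x < 1"
    using assms by (simp add: norm_mult)
  then have nz: "1 - ?x \<noteq> 0"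
    by (metis eq_iff_diff_eq_0 norm_one order_less_irrefl)
  have "(\<lambda>n. - (?x ^ n) / of_nat n) sums ln (1 - ?x)"
    using Ln_series'[of "- ?x"] x by simp
  then have s: "(\<lambda>n. - Re (- (?x ^ n) / of_nat n)) sums - Re (ln (1 - ?x))"
    by (intro sums_minus sums_Re)
  have "- Re (- (?x ^ n) / of_nat n) = r ^ n / n * Re ((z * cnj w) ^ n)" for n
    by (simp add: power_mult_distrib del: of_real_power flip: of_real_power)
  then show ?thesis
    using s Re_Ln[OF nz] by (simp only:)
qed

text \<open>With \<open>x = r * (z * cnj w)\<close> this is (1 - |x|^2) / (2 |1 - x|^2), half the
  Poisson kernel, in a form that expands by the geometric series.\<close>

definition half_poisson :: "real \<Rightarrow> complex \<Rightarrow> complex \<Rightarrow> real" where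
  "half_poisson r z w = Re (1 / (1 - r * (z * cnj w))) - 1 / 2"

text \<open>Real part of the geometric series; subtracting 1/2 changes only the constant term, from
  1 to 1/2.\<close>

lemma half_poisson_series:
  assumes "0 \<le> r" "r < 1" "cmod z = 1" "cmod w = 1"
  shows "(\<lambda>k. (r ^ k - (if k = 0 then 1 / 2 else 0)) * Re ((z * cnj w) ^ k)) sums half_poisson r z w"
proof -
  let ?x = "of_real r * (z * cnj w)"
  have "cmod ?x < 1"
    using assms by (simp add: norm_mult)
  then have "(\<lambda>n. Re (?x ^ n)) sums Re (1 / (1 - ?x))"
    by (intro sums_Re geometric_sums)
  from sums_diff[OF this sums_single[of 0 "\<lambda>_. 1 / 2"]]
  have "(\<lambda>n. Re (?x ^ n) - (if n = 0 then 1 / 2 else 0)) sums half_poisson r z w"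
    by (simp add: half_poisson_def)
  moreover have "Re (?x ^ n) - (if n = 0 then 1 / 2 else 0) =
      (r ^ n - (if n = 0 then 1 / 2 else 0)) * Re ((z * cnj w) ^ n)" for n
    by (simp add: power_mult_distrib del: of_real_power flip: of_real_power)
  ultimately show ?thesis by simp
qed

text \<open>Re (1 / (1 - x)) = Re (1 - x) / |1 - x|^2, and |x| < 1 gives |1 - x|^2 = 1 - 2 Re x +
  |x|^2 \<le> 2 Re (1 - x).\<close>

lemma half_poisson_nonneg:
  assumes "0 \<le> r" "r < 1" "cmod z = 1" "cmod w = 1"
  shows "half_poisson r z w \<ge> 0"
proof -
  let ?x = "of_real r * (z * cnj w)"
  have x: "cmod ?x < 1"
    using assms by (simp add: norm_mult)
  then have nz: "1 - ?x \<noteq> 0"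
    by (metis eq_iff_diff_eq_0 norm_one order_less_irrefl)
  have "(cmod (1 - ?x))\<^sup>2 = 1 - 2 * Re ?x + (cmod ?x)\<^sup>2"
    by (simp only: cmod_power2) (simp add: power2_eq_square algebra_simps)
  also have "\<dots> \<le> 2 * Re (1 - ?x)"
    using x by (simp add: power_le_one)
  finally have "1 / 2 \<le> Re (1 - ?x) / (cmod (1 - ?x))\<^sup>2"
    using nz by (simp add: field_simps)
  also have "\<dots> = Re (1 / (1 - ?x))"
    by (simp add: Re_divide' Re_divide cmod_power2)
  finally show ?thesis by (simp add: half_poisson_def)
qed

section \<open>The logarithmic kernel on the unit circle\<close>

text \<open>Haar measure has no atoms, since \<open>cis\<close> is injective on [0, 2 pi); by Fubini
  the diagonal is a null set. So \<open>ln 0 = 0\<close> and the value -\<infinity> of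
  \<open>log_kernel\<close> give the same integrals for densities.\<close>

lemma AE_off_diagonal: "AE p in haar2. fst p \<noteq> snd p"
proof (rule haar2.AE_pair_measure)
  show "{p \<in> space haar2. fst p \<noteq> snd p} \<in> sets haar2"
    by measurable
  show "AE z in circle_haar. AE w in circle_haar. fst (z, w) \<noteq> snd (z, w)"
  proof (rule AE_I2)
    fix z assume "z \<in> space circle_haar"
    then have z: "{z} \<in> sets circle_space"
      by (auto simp: space_circle_haar circle_space_def sets_restrict_space)
    have "{0..<2 * pi} \<inter> cis -` {z} \<subseteq> {Arg2pi z}"
      by (auto simp: cis_conv_exp Arg2pi_unique[of 1])
    then have "countable ({0..<2 * pi} \<inter> cis -` {z})"
      by (rule countable_subset) simp
    then have "emeasure circle_haar {z} = 0"
      by (simp add: emeasure_circle_haar[OF z] emeasure_lborel_countable)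
    then have "{z} \<in> null_sets circle_haar"
      using z by (simp add: null_sets_def sets_circle_haar)
    from AE_not_in[OF this] show "AE w in circle_haar. fst (z, w) \<noteq> snd (z, w)"
      by eventually_elim auto
  qed
qed

text \<open>Multiplication by the unimodular \<open>w\<close> relates the two sides. This identifies
  the kernel at r = 1 with the logarithmic kernel.\<close>

lemma cmod_one_minus_mult_cnj:
  assumes "cmod w = 1"
  shows "cmod (1 - z * cnj w) = cmod (z - w)"
proof -
  have "z - w = (z * cnj w - 1) * w"
    using complex_norm_square[of w] assms by (simp add: algebra_simps)
  then show ?thesis
    using assms by (simp add: norm_mult norm_minus_commute)
qed

text \<open>The triangle inequality bounds the modulus by 2; where it vanishes, the convention
  \<open>ln 0 = 0\<close> keeps the bound true.\<close>

lemma ln_cmod_le_ln2: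
  assumes "0 \<le> r" "r \<le> 1" "cmod z = 1" "cmod w = 1"
  shows "ln (cmod (1 - of_real r * (z * cnj w))) \<le> ln 2"
proof (cases "1 - of_real r * (z * cnj w) = 0")
  case False
  have "cmod (1 - of_real r * (z * cnj w)) \<le> 1 + cmod (of_real r * (z * cnj w))"
    by (metis norm_one norm_triangle_ineq4)
  also have "\<dots> \<le> 2"
    using assms by (simp add: norm_mult)
  finally show ?thesis using False by simp
qed auto

text \<open>A majorant independent of r, for dominated convergence. With
  \<open>x = z * cnj w\<close>, the identity 1 - x = (1 - r x) - (1 - r) x and |(1 - r) x| = 1 - r
  \<le> |1 - r x| give |1 - x| \<le> 2 |1 - r x|, hence the lower bound on the logarithm.\<close>

lemma abs_ln_cmod_le:
  assumes "1 / 2 \<le> r" "r \<le> 1" "cmod z = 1" "cmod w = 1" "z \<noteq> w"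
  shows "\<bar>ln (cmod (1 - of_real r * (z * cnj w)))\<bar> \<le> ln 2 + \<bar>ln (cmod (z - w))\<bar>"
proof -
  let ?x = "z * cnj w"
  have "cmod (of_real (1 - r) * ?x) \<le> cmod (1 - of_real r * ?x)"
  proof -
    have "1 - r \<le> cmod 1 - cmod (of_real r * ?x)"
      using assms by (simp add: norm_mult)
    also have "\<dots> \<le> cmod (1 - of_real r * ?x)"
      by (rule norm_triangle_ineq2)
    finally show ?thesis
      using assms by (simp add: norm_mult del: of_real_diff)
  qed
  moreover have "(1 - of_real r * ?x) - of_real (1 - r) * ?x = 1 - ?x"
    by (simp add: algebra_simps)
  ultimately have "cmod (1 - ?x) \<le> 2 * cmod (1 - of_real r * ?x)"
    using norm_triangle_ineq4[of "1 - of_real r * ?x" "of_real (1 - r) * ?x"] by (simp only:)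
  then have le: "cmod (z - w) / 2 \<le> cmod (1 - of_real r * ?x)"
    using assms by (simp add: cmod_one_minus_mult_cnj)
  have pos: "0 < cmod (z - w)" using assms by simp
  have "ln (cmod (z - w)) - ln 2 = ln (cmod (z - w) / 2)"
    using pos by (simp add: ln_div)
  also have "\<dots> \<le> ln (cmod (1 - of_real r * ?x))"
    using le pos by (intro ln_mono) auto
  finally show ?thesis
    using ln_cmod_le_ln2[of r z w] assms by auto
qed

text \<open>A concrete sequence increasing to 1, as the convergence theorems are sequential; the
  shift by 2 makes it start at 1/2, the lower bound in \<open>abs_ln_cmod_le\<close>.\<close>

definition radius :: "nat \<Rightarrow> real" where
  "radius n = 1 - 1 / (real n + 2)"

lemma radius_bounds: "0 \<le> radius n" "1 / 2 \<le> radius n" "radius n < 1" "radius n \<le> 1"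
  by (auto simp: radius_def field_simps)

lemma radius_tendsto: "radius \<longlonglongrightarrow> 1"
  unfolding radius_def by real_asymp

lemma ln_cmod_radius_tendsto:
  assumes "cmod w = 1" "z \<noteq> w"
  shows "(\<lambda>n. ln (cmod (1 - of_real (radius n) * (z * cnj w)))) \<longlonglongrightarrow> ln (cmod (z - w))"
proof -
  have "(\<lambda>n. ln (cmod (1 - of_real (radius n) * (z * cnj w)))) \<longlonglongrightarrow>
      ln (cmod (1 - of_real 1 * (z * cnj w)))"
    using assms cmod_one_minus_mult_cnj[of w z] by (intro tendsto_intros radius_tendsto) auto
  then show ?thesis
    using assms by (simp add: cmod_one_minus_mult_cnj)
qed

lemma
  fixes f g :: "complex \<Rightarrow> real"
  assumes "integrable circle_haar f" "integrable circle_haar g" "0 \<le> r" "r < 1"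
  shows integrable_log_kernel_radius: "integrable haar2
      (\<lambda>p. - ln (cmod (1 - of_real r * (fst p * cnj (snd p)))) * (f (fst p) * g (snd p)))"
    and log_kernel_radius_sums: "(\<lambda>k. r ^ k / k * coeff_product f g k) sums
      (\<integral>p. - ln (cmod (1 - of_real r * (fst p * cnj (snd p)))) * (f (fst p) * g (snd p)) \<partial>haar2)"
proof -
  have c: "summable (\<lambda>k. \<bar>r ^ k / real k\<bar>)"
  proof (rule summable_comparison_test'[of "\<lambda>k. r ^ k" 0])
    show "summable (\<lambda>k. r ^ k)" using assms by simp
    show "norm \<bar>r ^ k / real k\<bar> \<le> r ^ k" for k
      using assms divide_left_mono[of 1 "real k" "r ^ k"] by (cases "k = 0") auto
  qed
  note K = log_kernel_series[OF assms(3,4)]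
  show "integrable haar2
      (\<lambda>p. - ln (cmod (1 - of_real r * (fst p * cnj (snd p)))) * (f (fst p) * g (snd p)))"
    by (rule integrable_cosine_kernel[OF assms(1,2) c K])
  show "(\<lambda>k. r ^ k / k * coeff_product f g k) sums
      (\<integral>p. - ln (cmod (1 - of_real r * (fst p * cnj (snd p)))) * (f (fst p) * g (snd p)) \<partial>haar2)"
    by (rule cosine_kernel_sums[OF assms(1,2) c K])
qed

text \<open>Only the constant term of the expansion survives, so the integrals of the nonnegative functions
  \<open>ln 2 - ln \<bar>1 - r z cnj w\<bar>\<close> do not depend on \<open>r\<close>, and Fatou's lemma bounds the limit.\<close>

lemma integrable_log_uncorrelated:
  fixes f g :: "complex \<Rightarrow> real"
  assumes f: "integrable circle_haar f" "\<And>z. 0 \<le> f z"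
    and g: "integrable circle_haar g" "\<And>z. 0 \<le> g z"
    and fg: "\<And>k. k > 0 \<Longrightarrow> coeff_product f g k = 0"
  shows "integrable haar2 (\<lambda>p. ln (cmod (fst p - snd p)) * (f (fst p) * g (snd p)))"
proof -
  note [measurable] = borel_measurable_integrable[OF f(1)] borel_measurable_integrable[OF g(1)]
  define L where "L n p = ln (cmod (1 - of_real (radius n) * (fst p * cnj (snd p))))" for n p
  define u where "u n p = (ln 2 - L n p) * (f (fst p) * g (snd p))" for n p
  define v where "v p = (ln 2 - ln (cmod (fst p - snd p))) * (f (fst p) * g (snd p))" for p
  note I = integrable_tensor[OF f(1) g(1)]
  note LI = integrable_log_kernel_radius[OF f(1) g(1) radius_bounds(1,3), folded L_def]
  let ?C = "ln 2 * (\<integral>p. f (fst p) * g (snd p) \<partial>haar2)"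
  have u_eq: "u n = (\<lambda>p. ln 2 * (f (fst p) * g (snd p)) + - L n p * (f (fst p) * g (snd p)))" for n
    by (rule ext) (simp add: u_def algebra_simps)
  have ui: "integrable haar2 (u n)" for n
    unfolding u_eq by (intro Bochner_Integration.integrable_add integrable_mult_right I LI)
  \<comment> \<open>At k = 0 the weight is 0 by division by zero, and \<open>fg\<close> covers the
    other orders; hence the logarithmic part of \<open>u n\<close> integrates to 0.\<close>
  have "radius n ^ k / real k * coeff_product f g k = 0" for n k
    using fg by (cases "k = 0") auto
  then have "(\<lambda>k. radius n ^ k / real k * coeff_product f g k) = (\<lambda>_. 0)" for n
    by blast
  then have "(\<integral>p. - L n p * (f (fst p) * g (snd p)) \<partial>haar2) = 0" for n
    using sums_unique[OF log_kernel_radius_sums[OF f(1) g(1) radius_bounds(1,3)[of n], folded L_def]]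
    by (simp only: suminf_zero)
  then have uint: "(\<integral>p. u n p \<partial>haar2) = ?C" for n
    unfolding u_eq using I LI by (subst Bochner_Integration.integral_add) auto
  have unn: "AE p in haar2. 0 \<le> u n p" for n
    using f(2) g(2) ln_cmod_le_ln2[OF radius_bounds(1,4)] norm_space_haar2
    by (intro AE_I2) (simp add: u_def L_def)
  have vnn: "AE p in haar2. 0 \<le> v p"
    using f(2) g(2) ln_cmod_le_ln2[of 1] norm_space_haar2
    by (intro AE_I2) (simp add: v_def cmod_one_minus_mult_cnj)
  have [measurable]: "u n \<in> borel_measurable haar2" for n using ui by auto
  have vm [measurable]: "v \<in> borel_measurable haar2" unfolding v_def by measurable
  have "(\<integral>\<^sup>+ p. ennreal (v p) \<partial>haar2) = (\<integral>\<^sup>+ p. liminf (\<lambda>n. ennreal (u n p)) \<partial>haar2)"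
  proof (rule nn_integral_cong_AE)
    \<comment> \<open>On the diagonal \<open>L n\<close> tends to -\<infinity> while
      \<open>v\<close> uses \<open>ln 0 = 0\<close>, so convergence is claimed only off it.\<close>
    show "AE p in haar2. ennreal (v p) = liminf (\<lambda>n. ennreal (u n p))"
      using AE_off_diagonal AE_space
    proof eventually_elim
      case (elim p)
      have "(\<lambda>n. u n p) \<longlonglongrightarrow> v p"
        unfolding u_def v_def L_def
        using elim norm_space_haar2 by (intro tendsto_intros ln_cmod_radius_tendsto) auto
      then have "(\<lambda>n. ennreal (u n p)) \<longlonglongrightarrow> ennreal (v p)"
        by (rule tendsto_ennrealI)
      from lim_imp_Liminf[OF _ this] show ?case by simp
    qed
  qed
  also have "\<dots> \<le> liminf (\<lambda>n. \<integral>\<^sup>+ p. ennreal (u n p) \<partial>haar2)"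
    by (rule nn_integral_liminf) measurable
  also have "\<dots> = ennreal ?C"
    by (simp add: nn_integral_eq_integral[OF ui unn] uint Liminf_const)
  also have "\<dots> < \<infinity>" by simp
  finally have "integrable haar2 v"
    by (intro integrableI_nonneg vm vnn)
  with I have "integrable haar2 (\<lambda>p. ln 2 * (f (fst p) * g (snd p)) - v p)"
    by (intro Bochner_Integration.integrable_diff integrable_mult_right)
  then show ?thesis
    by (simp add: v_def algebra_simps)
qed

definition log_form :: "(complex \<Rightarrow> real) \<Rightarrow> (complex \<Rightarrow> real) \<Rightarrow> real" where
  "log_form f g = (\<integral>p. ln (cmod (fst p - snd p)) * (f (fst p) * g (snd p)) \<partial>haar2)"

text \<open>|f(z) g(w)| \<le> f(z)^2 + g(w)^2, and each square paired with the constant 1 satisfies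
  the hypotheses of \<open>integrable_log_uncorrelated\<close>.\<close>

lemma integrable_log_L2:
  fixes f g :: "complex \<Rightarrow> real"
  assumes [measurable]: "f \<in> borel_measurable circle_haar" "g \<in> borel_measurable circle_haar"
    and f: "integrable circle_haar (\<lambda>z. (f z)\<^sup>2)" and g: "integrable circle_haar (\<lambda>z. (g z)\<^sup>2)"
  shows "integrable haar2 (\<lambda>p. ln (cmod (fst p - snd p)) * (f (fst p) * g (snd p)))"
proof -
  let ?l = "\<lambda>p. ln (cmod (fst p - snd p))"
  have 1: "integrable haar2 (\<lambda>p. ?l p * ((f (fst p))\<^sup>2 * 1))"
    by (rule integrable_log_uncorrelated) (use f in \<open>auto simp: coeff_product_1_right\<close>)
  have 2: "integrable haar2 (\<lambda>p. ?l p * (1 * (g (snd p))\<^sup>2))"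
    by (rule integrable_log_uncorrelated) (use g in \<open>auto simp: coeff_product_1_left\<close>)
  have "integrable haar2 (\<lambda>p. \<bar>?l p * ((f (fst p))\<^sup>2 * 1)\<bar> + \<bar>?l p * (1 * (g (snd p))\<^sup>2)\<bar>)"
    using 1 2 by (intro Bochner_Integration.integrable_add integrable_abs)
  then show ?thesis
  proof (rule Bochner_Integration.integrable_bound)
    have "\<bar>x * y\<bar> \<le> x\<^sup>2 + y\<^sup>2" for x y :: real
      using sum_squares_bound[of "\<bar>x\<bar>" "\<bar>y\<bar>"] mult_nonneg_nonneg[OF abs_ge_zero abs_ge_zero, of x y]
      unfolding abs_mult power2_abs by linarith
    from mult_left_mono[OF this, of "\<bar>l\<bar>" for l]
    show "AE p in haar2. norm (?l p * (f (fst p) * g (snd p))) \<le>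
        norm (\<bar>?l p * ((f (fst p))\<^sup>2 * 1)\<bar> + \<bar>?l p * (1 * (g (snd p))\<^sup>2)\<bar>)"
      by (intro AE_I2) (simp add: abs_mult distrib_left)
  qed measurable
qed

text \<open>Dominated convergence off the diagonal: \<open>abs_ln_cmod_le\<close> supplies the
  majorant and \<open>integrable_log_L2\<close> its integrability.\<close>

lemma log_form_radius_tendsto:
  fixes f g :: "complex \<Rightarrow> real"
  assumes fm [measurable]: "f \<in> borel_measurable circle_haar"
    and gm [measurable]: "g \<in> borel_measurable circle_haar"
    and f: "integrable circle_haar (\<lambda>z. (f z)\<^sup>2)" and g: "integrable circle_haar (\<lambda>z. (g z)\<^sup>2)"
  shows "(\<lambda>n. \<integral>p. - ln (cmod (1 - of_real (radius n) * (fst p * cnj (snd p)))) * (f (fst p) * g (snd p)) \<partial>haar2)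
    \<longlonglongrightarrow> - log_form f g"
proof -
  let ?l = "\<lambda>p. ln (cmod (fst p - snd p))"
  note fi = haar.square_integrable_imp_integrable[OF fm f]
    and gi = haar.square_integrable_imp_integrable[OF gm g]
  note lim_meas = borel_measurable_integrable[OF integrable_log_L2[OF assms]]
    borel_measurable_integrable[OF integrable_log_kernel_radius[OF fi gi radius_bounds(1,3)]]
  have "(\<lambda>n. \<integral>p. - ln (cmod (1 - of_real (radius n) * (fst p * cnj (snd p)))) * (f (fst p) * g (snd p)) \<partial>haar2)
    \<longlonglongrightarrow> (\<integral>p. - ?l p * (f (fst p) * g (snd p)) \<partial>haar2)"
  proof (rule integral_dominated_convergence)
    show "integrable haar2 (\<lambda>p. ln 2 * \<bar>f (fst p) * g (snd p)\<bar> + \<bar>?l p * (f (fst p) * g (snd p))\<bar>)"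
      using integrable_tensor[OF fi gi] integrable_log_L2[OF assms]
      by (intro Bochner_Integration.integrable_add integrable_mult_right integrable_abs)
    show "AE p in haar2. (\<lambda>n. - ln (cmod (1 - of_real (radius n) * (fst p * cnj (snd p)))) * (f (fst p) * g (snd p)))
        \<longlonglongrightarrow> - ?l p * (f (fst p) * g (snd p))"
      using AE_off_diagonal AE_space
      by eventually_elim (intro tendsto_intros ln_cmod_radius_tendsto norm_space_haar2)
    show "AE p in haar2. norm (- ln (cmod (1 - of_real (radius n) * (fst p * cnj (snd p)))) * (f (fst p) * g (snd p)))
        \<le> ln 2 * \<bar>f (fst p) * g (snd p)\<bar> + \<bar>?l p * (f (fst p) * g (snd p))\<bar>" for n
      using AE_off_diagonal AE_space
    proof eventually_elim
      case (elim p)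
      from mult_right_mono[OF abs_ln_cmod_le[OF radius_bounds(2,4) norm_space_haar2[OF elim(2)] elim(1)]
          abs_ge_zero[of "f (fst p) * g (snd p)"]]
      show ?case by (simp add: abs_mult distrib_right)
    qed
  qed (use lim_meas in auto)
  then show ?thesis by (simp add: log_form_def)
qed

section \<open>The energy inequality for square-integrable densities\<close>

lemma coeff_product_self_nonneg: "0 \<le> coeff_product f f k"
  by (simp add: coeff_product_def)

lemma log_form_le:
  fixes h :: "complex \<Rightarrow> real"
  assumes hm: "h \<in> borel_measurable circle_haar"
    and h2: "integrable circle_haar (\<lambda>z. (h z)\<^sup>2)"
  shows "- log_form h h \<le> (\<integral>z. (h z)\<^sup>2 \<partial>circle_haar) / 2"
proof -
  have hi: "integrable circle_haar h"
    by (rule haar.square_integrable_imp_integrable[OF hm h2])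
  let ?I = "\<integral>z. (h z)\<^sup>2 \<partial>circle_haar"
  have "(\<integral>p. - ln (cmod (1 - of_real r * (fst p * cnj (snd p)))) * (h (fst p) * h (snd p)) \<partial>haar2) \<le> ?I / 2"
    if r: "0 \<le> r" "r < 1" for r
  proof -
    \<comment> \<open>The cosine coefficients of \<open>half_poisson r\<close>: 1/2 at order 0, then
      \<open>r ^ k\<close>.\<close>
    define c where "c k = r ^ k - (if k = 0 then 1 / 2 else 0)" for k
    have c: "summable (\<lambda>k. \<bar>c k\<bar>)"
    proof (rule summable_comparison_test'[of "\<lambda>k. r ^ k" 0])
      show "summable (\<lambda>k. r ^ k)" using r by simp
      show "norm \<bar>c k\<bar> \<le> r ^ k" for k using r by (simp add: c_def)
    qed
    have P_int: "integrable haar2 (\<lambda>p. half_poisson r (fst p) (snd p) * (f (fst p) * g (snd p)))"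
      and P_sums: "(\<lambda>k. c k * coeff_product f g k) sums
        (\<integral>p. half_poisson r (fst p) (snd p) * (f (fst p) * g (snd p)) \<partial>haar2)"
      if "integrable circle_haar f" "integrable circle_haar g" for f g
      by (rule integrable_cosine_kernel[OF that c half_poisson_series[OF r, folded c_def]]
          cosine_kernel_sums[OF that c half_poisson_series[OF r, folded c_def]]; assumption)+
    \<comment> \<open>Only order 0 contributes, with weight 1/2. This is applied to the pairs (h^2,
      1) and (1, h^2).\<close>
    have P_one: "(\<integral>p. half_poisson r (fst p) (snd p) * (f (fst p) * g (snd p)) \<partial>haar2) = ?I / 2"
      if i: "integrable circle_haar f" "integrable circle_haar g"
        and fg: "\<And>k. k > 0 \<Longrightarrow> coeff_product f g k = 0" "coeff_product f g 0 = ?I" for f g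
    proof -
      have "(\<lambda>k. c k * coeff_product f g k) = (\<lambda>k. if k = 0 then ?I / 2 else 0)"
        using fg by (auto simp: c_def)
      then have "(\<lambda>k. c k * coeff_product f g k) sums (?I / 2)"
        using sums_single[of 0 "\<lambda>_. ?I / 2"] by (simp only:)
      then show ?thesis
        by (rule sums_unique2[OF P_sums[OF i]])
    qed
    have 1: "(\<integral>p. half_poisson r (fst p) (snd p) * ((h (fst p))\<^sup>2 * 1) \<partial>haar2) = ?I / 2"
      by (rule P_one) (use h2 in \<open>auto simp: coeff_product_1_right coeff_product_0 haar.prob_space\<close>)
    have 2: "(\<integral>p. half_poisson r (fst p) (snd p) * (1 * (h (snd p))\<^sup>2) \<partial>haar2) = ?I / 2"
      by (rule P_one) (use h2 in \<open>auto simp: coeff_product_1_left coeff_product_0 haar.prob_space\<close>)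
    have i1: "integrable haar2 (\<lambda>p. half_poisson r (fst p) (snd p) * ((h (fst p))\<^sup>2 * 1))"
      by (rule P_int) (use h2 in auto)
    have i2: "integrable haar2 (\<lambda>p. half_poisson r (fst p) (snd p) * (1 * (h (snd p))\<^sup>2))"
      by (rule P_int) (use h2 in auto)
    \<comment> \<open>The weights compare as 0 \<le> 1/2 at order 0 and r^k / k \<le> r^k beyond;
      the products are sums of squares because both arguments are \<open>h\<close>.\<close>
    have "r ^ k / k * coeff_product h h k \<le> c k * coeff_product h h k" for k
    proof (rule mult_right_mono[OF _ coeff_product_self_nonneg])
      show "r ^ k / k \<le> c k"
        using r divide_left_mono[of 1 "real k" "r ^ k"] by (cases "k = 0") (auto simp: c_def)
    qed
    then have "(\<integral>p. - ln (cmod (1 - of_real r * (fst p * cnj (snd p)))) * (h (fst p) * h (snd p)) \<partial>haar2)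
        \<le> (\<integral>p. half_poisson r (fst p) (snd p) * (h (fst p) * h (snd p)) \<partial>haar2)"
      by (rule sums_le[OF _ log_kernel_radius_sums[OF hi hi r] P_sums[OF hi hi]])
    \<comment> \<open>Since the half Poisson kernel is nonnegative, 2 h(z) h(w) \<le> h(z)^2 +
      h(w)^2 can be integrated against it.\<close>
    also have "\<dots> \<le> (\<integral>p. (half_poisson r (fst p) (snd p) * ((h (fst p))\<^sup>2 * 1) +
        half_poisson r (fst p) (snd p) * (1 * (h (snd p))\<^sup>2)) / 2 \<partial>haar2)"
    proof (rule integral_mono)
      fix p assume "p \<in> space haar2"
      then have "0 \<le> half_poisson r (fst p) (snd p)"
        using half_poisson_nonneg[OF r] norm_space_haar2 by blast
      moreover have "h (fst p) * h (snd p) \<le> ((h (fst p))\<^sup>2 + (h (snd p))\<^sup>2) / 2"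
        using sum_squares_bound[of "h (fst p)" "h (snd p)"] by simp
      ultimately have "half_poisson r (fst p) (snd p) * (h (fst p) * h (snd p)) \<le>
          half_poisson r (fst p) (snd p) * (((h (fst p))\<^sup>2 + (h (snd p))\<^sup>2) / 2)"
        by (intro mult_left_mono)
      then show "half_poisson r (fst p) (snd p) * (h (fst p) * h (snd p)) \<le>
          (half_poisson r (fst p) (snd p) * ((h (fst p))\<^sup>2 * 1) +
           half_poisson r (fst p) (snd p) * (1 * (h (snd p))\<^sup>2)) / 2"
        by (simp add: distrib_left)
    qed (use P_int[OF hi hi] i1 i2 in \<open>auto intro!: integrable_divide Bochner_Integration.integrable_add\<close>)
    also have "\<dots> = ?I / 2"
      using Bochner_Integration.integral_add[OF i1 i2] 1 2 by simp
    finally show ?thesis .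
  qed
  \<comment> \<open>The bound is uniform in r, so it passes to the limit along
    \<open>radius\<close>.\<close>
  then show ?thesis
    using LIMSEQ_le_const2[OF log_form_radius_tendsto[OF hm hm h2 h2]] radius_bounds by blast
qed

text \<open>On the circle, multiplying the harmonic of order k + 1 by Re z or Im z yields only
  harmonics of orders k and k + 2, and only order 0 has a nonzero mean.\<close>

lemma
  fixes h :: "complex \<Rightarrow> real"
  assumes [measurable]: "h \<in> borel_measurable circle_haar"
    and h: "AE z in circle_haar. h z = a * Re z + b * Im z"
  shows haar_cos_linear: "haar_cos h (Suc k) = (if k = 0 then a / 2 else 0)"
    and haar_sin_linear: "haar_sin h (Suc k) = (if k = 0 then b / 2 else 0)"
proof -
  have sq: "cnj z * z ^ Suc k = z ^ k" if "cmod z = 1" for z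
    using complex_norm_square[of z] that by (simp add: mult.assoc[symmetric] mult.commute)
  \<comment> \<open>Product-to-sum formulas, from the real and imaginary parts of
    \<open>z * z ^ Suc k\<close> and \<open>cnj z * z ^ Suc k\<close>.\<close>
  have R: "Re z * Re (z ^ Suc k) = (Re (z ^ k) + Re (z ^ (k + 2))) / 2"
    "Im z * Im (z ^ Suc k) = (Re (z ^ k) - Re (z ^ (k + 2))) / 2"
    "Re z * Im (z ^ Suc k) = (Im (z ^ (k + 2)) + Im (z ^ k)) / 2"
    "Im z * Re (z ^ Suc k) = (Im (z ^ (k + 2)) - Im (z ^ k)) / 2" if z: "cmod z = 1" for z
  proof -
    have "z ^ (k + 2) = z * z ^ Suc k" by simp
    then show "Re z * Re (z ^ Suc k) = (Re (z ^ k) + Re (z ^ (k + 2))) / 2"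
      "Im z * Im (z ^ Suc k) = (Re (z ^ k) - Re (z ^ (k + 2))) / 2"
      "Re z * Im (z ^ Suc k) = (Im (z ^ (k + 2)) + Im (z ^ k)) / 2"
      "Im z * Re (z ^ Suc k) = (Im (z ^ (k + 2)) - Im (z ^ k)) / 2"
      unfolding sq[OF z, symmetric] by (simp_all only: times_complex.sel cnj.sel) (simp_all add: field_simps)
  qed
  have lin: "(\<lambda>z. a * Re z + b * Im z) \<in> borel_measurable circle_haar"
    by (intro measurable_haar_continuous continuous_intros)
  have i: "integrable circle_haar (\<lambda>z. Re (z ^ j))" "integrable circle_haar (\<lambda>z. Im (z ^ j))" for j
    using integrable_haar_power by (auto intro!: integrable_Re integrable_Im)
  have v: "(\<integral>z. Re (z ^ k) \<partial>circle_haar) = (if k = 0 then 1 else 0)"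
    "(\<integral>z. Im (z ^ k) \<partial>circle_haar) = 0"
    using integral_haar_Re_power[of k] integral_haar_Im_power[of k]
    by (cases "k = 0"; simp add: haar.prob_space)+
  have "haar_cos h (Suc k) = (\<integral>z. (a * Re z + b * Im z) * Re (z ^ Suc k) \<partial>circle_haar)"
    unfolding haar_cos_def
  proof (rule integral_cong_AE)
    show "AE z in circle_haar. h z * Re (z ^ Suc k) = (a * Re z + b * Im z) * Re (z ^ Suc k)"
      using h by eventually_elim simp
  qed (intro borel_measurable_times lin measurable_Re_power assms)+
  also have "\<dots> = (\<integral>z. a * ((Re (z ^ k) + Re (z ^ (k + 2))) / 2) +
      b * ((Im (z ^ (k + 2)) - Im (z ^ k)) / 2) \<partial>circle_haar)"
    by (rule Bochner_Integration.integral_cong[OF refl])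
       (simp only: distrib_right mult.assoc R space_circle_haar mem_sphere_0)
  also have "\<dots> = (if k = 0 then a / 2 else 0)"
    using i integral_haar_Re_power[of "k + 2"] integral_haar_Im_power[of "k + 2"]
    by (simp add: v del: power_Suc)
  finally show "haar_cos h (Suc k) = (if k = 0 then a / 2 else 0)" .
  have "haar_sin h (Suc k) = (\<integral>z. (a * Re z + b * Im z) * Im (z ^ Suc k) \<partial>circle_haar)"
    unfolding haar_sin_def
  proof (rule integral_cong_AE)
    show "AE z in circle_haar. h z * Im (z ^ Suc k) = (a * Re z + b * Im z) * Im (z ^ Suc k)"
      using h by eventually_elim simp
  qed (intro borel_measurable_times lin measurable_Im_power assms)+
  also have "\<dots> = (\<integral>z. a * ((Im (z ^ (k + 2)) + Im (z ^ k)) / 2) +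
      b * ((Re (z ^ k) - Re (z ^ (k + 2))) / 2) \<partial>circle_haar)"
    by (rule Bochner_Integration.integral_cong[OF refl])
       (simp only: distrib_right mult.assoc R space_circle_haar mem_sphere_0)
  also have "\<dots> = (if k = 0 then b / 2 else 0)"
    using i integral_haar_Re_power[of "k + 2"] integral_haar_Im_power[of "k + 2"]
    by (simp add: v del: power_Suc)
  finally show "haar_sin h (Suc k) = (if k = 0 then b / 2 else 0)" .
qed

text \<open>Only order 1 survives, and there 1 / k = 1. With m = (a^2 + b^2) / 4 the energy at
  radius r is r m, which tends to m, while the integral of h^2 is 2 m.\<close>

lemma log_form_linear:
  fixes h :: "complex \<Rightarrow> real"
  assumes hm [measurable]: "h \<in> borel_measurable circle_haar"
    and h2: "integrable circle_haar (\<lambda>z. (h z)\<^sup>2)"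
    and h: "AE z in circle_haar. h z = a * Re z + b * Im z"
  shows "- log_form h h = (\<integral>z. (h z)\<^sup>2 \<partial>circle_haar) / 2"
proof -
  have hi: "integrable circle_haar h"
    by (rule haar.square_integrable_imp_integrable[OF hm h2])
  let ?m = "coeff_product h h 1"
  have first: "haar_cos h 1 = a / 2" "haar_sin h 1 = b / 2"
    using haar_cos_linear[OF hm h, of 0] haar_sin_linear[OF hm h, of 0] by simp_all
  have m: "?m = (a\<^sup>2 + b\<^sup>2) / 4"
    unfolding coeff_product_def first
    by (simp add: power2_eq_square add_divide_distrib)
  have k: "coeff_product h h k = 0" if "k \<noteq> 1" "k \<noteq> 0" for k
    using that haar_cos_linear[OF hm h, of "k - 1"] haar_sin_linear[OF hm h, of "k - 1"]
    by (simp add: coeff_product_def)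
  have "(\<integral>p. - ln (cmod (1 - of_real (radius n) * (fst p * cnj (snd p)))) * (h (fst p) * h (snd p)) \<partial>haar2)
      = radius n * ?m" for n
  proof -
    have "(\<lambda>k. radius n ^ k / k * coeff_product h h k) = (\<lambda>k. if k = 1 then radius n * ?m else 0)"
    proof
      \<comment> \<open>Order 0 drops out because its weight is a division by zero; orders above 1
        vanish by \<open>k\<close>.\<close>
      show "radius n ^ j / j * coeff_product h h j = (if j = 1 then radius n * ?m else 0)" for j
        using k[of j] by (cases "j = 0") auto
    qed
    then have "(\<lambda>k. radius n ^ k / k * coeff_product h h k) sums (radius n * ?m)"
      using sums_single[of 1 "\<lambda>_. radius n * ?m"] by (simp only:)
    then show ?thesis
      by (rule sums_unique2[OF log_kernel_radius_sums[OF hi hi radius_bounds(1,3)]])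
  qed
  then have "(\<lambda>n. radius n * ?m) \<longlonglongrightarrow> - log_form h h"
    using log_form_radius_tendsto[OF hm hm h2 h2] by simp
  moreover have "(\<lambda>n. radius n * ?m) \<longlonglongrightarrow> 1 * ?m"
    by (intro tendsto_intros radius_tendsto)
  ultimately have "- log_form h h = ?m"
    using LIMSEQ_unique by fastforce
  moreover have "(\<integral>z. (h z)\<^sup>2 \<partial>circle_haar) = 2 * ?m"
  proof -
    have [measurable]: "Re \<in> borel_measurable circle_haar" "Im \<in> borel_measurable circle_haar"
      using measurable_Re_power[of 1] measurable_Im_power[of 1] by simp_all
    have i: "integrable circle_haar (\<lambda>z. h z * Re z)" "integrable circle_haar (\<lambda>z. h z * Im z)"
      using integrable_haar_bounded_mult[OF hi measurable_Re_power Re_power_le, of 1]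
        integrable_haar_bounded_mult[OF hi measurable_Im_power Im_power_le, of 1] by simp_all
    \<comment> \<open>Replacing just one factor \<open>h\<close> by its linear form leaves the first
      coefficients of \<open>h\<close>, which are already known.\<close>
    have "(\<integral>z. (h z)\<^sup>2 \<partial>circle_haar) = (\<integral>z. a * (h z * Re z) + b * (h z * Im z) \<partial>circle_haar)"
    proof (rule integral_cong_AE)
      show "AE z in circle_haar. (h z)\<^sup>2 = a * (h z * Re z) + b * (h z * Im z)"
        using h by eventually_elim (simp add: power2_eq_square algebra_simps)
    qed measurable
    also have "\<dots> = a * haar_cos h 1 + b * haar_sin h 1"
      using i by (simp add: haar_cos_def haar_sin_def)
    also have "\<dots> = 2 * ?m"
      unfolding m first
      by (simp add: power2_eq_square add_divide_distrib)
    finally show ?thesis .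
  qed
  ultimately show ?thesis by simp
qed

section \<open>Measures with square-integrable densities\<close>

text \<open>The product measure has density f(z) g(w), and off the null diagonal the extended kernel
  is the real logarithm. By \<open>integrable_log_L2\<close> both parts are finite, so their
  extended difference is the ordinary integral.\<close>

lemma log_integral_density:
  fixes f g :: "complex \<Rightarrow> real"
  assumes \<mu>: "\<mu> = density circle_haar (\<lambda>z. ennreal (f z))" "\<And>z. 0 \<le> f z"
      "f \<in> borel_measurable circle_haar" "integrable circle_haar (\<lambda>z. (f z)\<^sup>2)"
    and \<nu>: "\<nu> = density circle_haar (\<lambda>z. ennreal (g z))" "\<And>z. 0 \<le> g z"
      "g \<in> borel_measurable circle_haar" "integrable circle_haar (\<lambda>z. (g z)\<^sup>2)"
    and "prob_space \<nu>"
  shows "log_integral \<mu> \<nu> = ereal (log_form f g)"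
proof -
  note [measurable] = \<mu>(3) \<nu>(3)
  interpret N: prob_space \<nu> by fact
  let ?G = "\<lambda>p. ln (cmod (fst p - snd p)) * (f (fst p) * g (snd p))"
  have prod: "\<mu> \<Otimes>\<^sub>M \<nu> = density haar2 (\<lambda>(z, w). ennreal (f z) * ennreal (g w))"
    unfolding \<mu>(1) \<nu>(1)
    by (rule pair_measure_density)
       (use N.sigma_finite_measure_axioms haar.sigma_finite_measure_axioms in \<open>auto simp: \<nu>(1)\<close>)
  have K [measurable]: "(\<lambda>p. log_kernel (fst p) (snd p)) \<in> borel_measurable haar2"
  proof -
    \<comment> \<open>The test z = w is rewritten as a condition on a measurable real
      function.\<close>
    have "(\<lambda>p. if cmod (fst p - snd p) = 0 then - \<infinity> else ereal (ln (cmod (fst p - snd p))))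
        \<in> borel_measurable haar2"
      by measurable
    then show ?thesis by (simp add: log_kernel_def)
  qed
  have nn: "(\<integral>\<^sup>+ (z, w). e2ennreal (s * log_kernel z w) \<partial>(\<mu> \<Otimes>\<^sub>M \<nu>)) =
      (\<integral>\<^sup>+ p. ennreal (real_of_ereal s * ?G p) \<partial>haar2)" if s: "s = 1 \<or> s = -1" for s
  proof -
    have "(\<integral>\<^sup>+ (z, w). e2ennreal (s * log_kernel z w) \<partial>(\<mu> \<Otimes>\<^sub>M \<nu>)) =
        (\<integral>\<^sup>+ p. ennreal (f (fst p)) * ennreal (g (snd p)) * e2ennreal (s * log_kernel (fst p) (snd p)) \<partial>haar2)"
      unfolding prod split_beta by (rule nn_integral_density) measurable
    also have "\<dots> = (\<integral>\<^sup>+ p. ennreal (real_of_ereal s * ?G p) \<partial>haar2)"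
    proof (rule nn_integral_cong_AE)
      show "AE p in haar2. ennreal (f (fst p)) * ennreal (g (snd p)) * e2ennreal (s * log_kernel (fst p) (snd p))
          = ennreal (real_of_ereal s * ?G p)"
        using AE_off_diagonal
      proof eventually_elim
        case (elim p)
        \<comment> \<open>Both \<open>ennreal\<close> and \<open>e2ennreal\<close> cut negative
          values off at 0, which commutes with the nonnegative factor f(z) g(w).\<close>
        have "ennreal (f (fst p)) * ennreal (g (snd p)) * e2ennreal (s * log_kernel (fst p) (snd p)) =
            ennreal (f (fst p) * g (snd p)) * ennreal (real_of_ereal s * ln (cmod (fst p - snd p)))"
          using elim s \<mu>(2) \<nu>(2) by (auto simp: log_kernel_def ennreal_mult)
        also have "\<dots> = ennreal ((f (fst p) * g (snd p)) * (real_of_ereal s * ln (cmod (fst p - snd p))))"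
          using \<mu>(2) \<nu>(2) by (simp add: ennreal_mult')
        finally show ?case by (simp add: ac_simps)
      qed
    qed
    finally show ?thesis .
  qed
  have nn': "(\<integral>\<^sup>+ (z, w). e2ennreal (log_kernel z w) \<partial>(\<mu> \<Otimes>\<^sub>M \<nu>)) = (\<integral>\<^sup>+ p. ennreal (?G p) \<partial>haar2)"
    "(\<integral>\<^sup>+ (z, w). e2ennreal (- log_kernel z w) \<partial>(\<mu> \<Otimes>\<^sub>M \<nu>)) = (\<integral>\<^sup>+ p. ennreal (- ?G p) \<partial>haar2)"
    using nn[of 1] nn[of "-1"] by simp_all
  have G: "integrable haar2 ?G"
    by (rule integrable_log_L2[OF \<mu>(3) \<nu>(3) \<mu>(4) \<nu>(4)])
  have "log_form f g = enn2real (\<integral>\<^sup>+ p. ennreal (?G p) \<partial>haar2) - enn2real (\<integral>\<^sup>+ p. ennreal (- ?G p) \<partial>haar2)"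
    unfolding log_form_def by (rule real_lebesgue_integral_def[OF G])
  moreover have "enn2ereal x = ereal (enn2real x)" if "x \<noteq> \<infinity>" for x
    using that by (cases x) auto
  ultimately show ?thesis
    using G unfolding log_integral_def nn' real_integrable_def by simp
qed

text \<open>\<open>enn2real\<close> sends \<infinity> to 0; for an absolutely continuous probability
  measure this alters the derivative only on a null set.\<close>

definition real_density :: "complex measure \<Rightarrow> complex \<Rightarrow> real" where
  "real_density \<mu> z = enn2real (RN_deriv circle_haar \<mu> z)"

lemma measurable_real_density [measurable]: "real_density \<mu> \<in> borel_measurable circle_haar"
  unfolding real_density_def by measurable

lemma real_density_nonneg: "0 \<le> real_density \<mu> z"
  by (simp add: real_density_def)

lemma
  assumes \<mu>: "circle_prob \<mu>" and L2: "has_L2_density \<mu>"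
  shows density_real_density: "\<mu> = density circle_haar (\<lambda>z. ennreal (real_density \<mu> z))"
    and integrable_real_density_square: "integrable circle_haar (\<lambda>z. (real_density \<mu> z)\<^sup>2)"
proof -
  have ac: "absolutely_continuous circle_haar \<mu>" and s: "sets \<mu> = sets circle_haar"
    using \<mu> L2 by (auto simp: has_L2_density_def circle_prob_def sets_circle_haar)
  interpret M: prob_space \<mu> using \<mu> by (simp add: circle_prob_def)
  have fin: "AE z in circle_haar. RN_deriv circle_haar \<mu> z \<noteq> \<infinity>"
    by (rule haar.RN_deriv_finite[OF M.sigma_finite_measure_axioms ac s])
  then have eq: "AE z in circle_haar. RN_deriv circle_haar \<mu> z = ennreal (real_density \<mu> z)"
    by eventually_elim (simp add: real_density_def less_top)
  have "\<mu> = density circle_haar (RN_deriv circle_haar \<mu>)"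
    using haar.density_RN_deriv[OF ac s] by simp
  also have "\<dots> = density circle_haar (\<lambda>z. ennreal (real_density \<mu> z))"
    using eq by (intro density_cong) auto
  finally show "\<mu> = density circle_haar (\<lambda>z. ennreal (real_density \<mu> z))" .
  have "(\<integral>\<^sup>+ z. ennreal ((real_density \<mu> z)\<^sup>2) \<partial>circle_haar) = (\<integral>\<^sup>+ z. (RN_deriv circle_haar \<mu> z)\<^sup>2 \<partial>circle_haar)"
    using eq by (intro nn_integral_cong_AE, eventually_elim) (simp add: ennreal_power real_density_nonneg)
  also have "\<dots> < \<infinity>"
    using L2 by (simp add: has_L2_density_def)
  finally show "integrable circle_haar (\<lambda>z. (real_density \<mu> z)\<^sup>2)"
    by (intro integrableI_nonneg) auto
qed

text \<open>Bilinearity, justified by the integrability of all four terms; the grouping is that of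
  \<open>log_energy_distance\<close>.\<close>

lemma log_form_diff:
  fixes f g :: "complex \<Rightarrow> real"
  assumes "f \<in> borel_measurable circle_haar" "g \<in> borel_measurable circle_haar"
    "integrable circle_haar (\<lambda>z. (f z)\<^sup>2)" "integrable circle_haar (\<lambda>z. (g z)\<^sup>2)"
  shows "log_form (\<lambda>z. f z - g z) (\<lambda>z. f z - g z) =
    log_form f f - log_form f g - (log_form g f - log_form g g)"
proof -
  note i = integrable_log_L2[OF assms(1,1,3,3)] integrable_log_L2[OF assms(1,2,3,4)]
    integrable_log_L2[OF assms(2,1,4,3)] integrable_log_L2[OF assms(2,2,4,4)]
  let ?l = "\<lambda>p. ln (cmod (fst p - snd p))"
  have "log_form (\<lambda>z. f z - g z) (\<lambda>z. f z - g z) =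
      (\<integral>p. (?l p * (f (fst p) * f (snd p)) - ?l p * (f (fst p) * g (snd p))) -
        (?l p * (g (fst p) * f (snd p)) - ?l p * (g (fst p) * g (snd p))) \<partial>haar2)"
    unfolding log_form_def by (rule Bochner_Integration.integral_cong) (auto simp: algebra_simps)
  also have "\<dots> = log_form f f - log_form f g - (log_form g f - log_form g g)"
    using i by (simp add: log_form_def)
  finally show ?thesis .
qed

text \<open>The finiteness condition in the equality clause excludes cases such as \<mu> = \<nu> of
  finite energy without a square-integrable density, where the left side is 0 and the right side
  \<infinity>. The identity over all \<open>A\<close> expresses \<mu> - \<nu> as a signed
  measure.\<close>

theorem theorem13:
  fixes \<mu> \<nu> :: "complex measure"
  assumes "circle_prob \<mu>" and "circle_prob \<nu>"
    and "finite_log_energy \<mu>" and "finite_log_energy \<nu>"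
  shows "log_energy_distance \<mu> \<nu> \<le> L2_density_distance \<mu> \<nu> / 2 \<and>
    (L2_density_distance \<mu> \<nu> < \<infinity> \<and>
     (\<exists>a b :: real. \<forall>A \<in> sets circle_space.
        measure \<mu> A - measure \<nu> A = (\<integral> z \<in> A. (a * Re z + b * Im z) \<partial>circle_haar)) \<longrightarrow>
     log_energy_distance \<mu> \<nu> = L2_density_distance \<mu> \<nu> / 2)"
proof (cases "has_L2_density \<mu> \<and> has_L2_density \<nu>")
  case False
  then have "L2_density_distance \<mu> \<nu> = \<infinity>"
    by (auto simp: L2_density_distance_def)
  then show ?thesis by simp
next
  case True
  define f where "f = real_density \<mu>"
  define g where "g = real_density \<nu>"
  define h where "h z = f z - g z" for z
  have prob: "prob_space \<mu>" "prob_space \<nu>"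
    using assms by (auto simp: circle_prob_def)
  have nn: "0 \<le> f z" "0 \<le> g z" for z
    by (auto simp: f_def g_def real_density_nonneg)
  have fm [measurable]: "f \<in> borel_measurable circle_haar"
    and gm [measurable]: "g \<in> borel_measurable circle_haar"
    by (auto simp: f_def g_def)
  have hm [measurable]: "h \<in> borel_measurable circle_haar"
    unfolding h_def by measurable
  have f2: "integrable circle_haar (\<lambda>z. (f z)\<^sup>2)" and g2: "integrable circle_haar (\<lambda>z. (g z)\<^sup>2)"
    using assms True by (auto simp: f_def g_def integrable_real_density_square)
  have f: "\<mu> = density circle_haar (\<lambda>z. ennreal (f z))" and g: "\<nu> = density circle_haar (\<lambda>z. ennreal (g z))"
    using assms True density_real_density by (auto simp: f_def g_def)
  have h2: "integrable circle_haar (\<lambda>z. (h z)\<^sup>2)"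
  proof (rule Bochner_Integration.integrable_bound)
    show "integrable circle_haar (\<lambda>z. (f z)\<^sup>2 + (g z)\<^sup>2)"
      using f2 g2 by simp
    \<comment> \<open>(f - g)^2 \<le> f^2 + g^2 because f g \<ge> 0.\<close>
    show "AE z in circle_haar. norm ((h z)\<^sup>2) \<le> norm ((f z)\<^sup>2 + (g z)\<^sup>2)"
      using mult_nonneg_nonneg[OF nn] by (intro AE_I2) (simp add: h_def power2_diff mult.assoc abs_le_iff
        sum_squares_bound[simplified mult.assoc])
  qed measurable
  have energy: "log_energy_distance \<mu> \<nu> = ereal (- log_form h h)"
    unfolding log_energy_distance_def h_def log_form_diff[OF fm gm f2 g2]
    by (simp add: log_integral_density[OF f nn(1) fm f2 f nn(1) fm f2 prob(1)]
        log_integral_density[OF f nn(1) fm f2 g nn(2) gm g2 prob(2)]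
        log_integral_density[OF g nn(2) gm g2 f nn(1) fm f2 prob(1)]
        log_integral_density[OF g nn(2) gm g2 g nn(2) gm g2 prob(2)])
  have dist: "L2_density_distance \<mu> \<nu> / 2 = ereal ((\<integral>z. (h z)\<^sup>2 \<partial>circle_haar) / 2)"
    using True by (simp add: L2_density_distance_def h_def f_def g_def real_density_def)
  have "- log_form h h = (\<integral>z. (h z)\<^sup>2 \<partial>circle_haar) / 2"
    if ab: "\<And>A. A \<in> sets circle_space \<Longrightarrow>
        measure \<mu> A - measure \<nu> A = (\<integral> z \<in> A. (a * Re z + b * Im z) \<partial>circle_haar)" for a b
  proof (rule log_form_linear[OF hm h2])
    have fi: "integrable circle_haar f" and gi: "integrable circle_haar g"
      by (auto intro!: haar.square_integrable_imp_integrable f2 g2)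
    have m: "measure (density circle_haar (\<lambda>z. ennreal (k z))) A = (\<integral>z\<in>A. k z \<partial>circle_haar)"
      if "integrable circle_haar k" "\<And>z. 0 \<le> k z" "A \<in> sets circle_haar" for k A
    proof -
      have "emeasure (density circle_haar (\<lambda>z. ennreal (k z))) A = (\<integral>\<^sup>+z. ennreal (indicator A z * k z) \<partial>circle_haar)"
        using that by (subst emeasure_density) (auto intro!: nn_integral_cong split: split_indicator)
      also have "\<dots> = ennreal (\<integral>z. indicator A z * k z \<partial>circle_haar)"
        using that integrable_mult_indicator[of A circle_haar k]
        by (intro nn_integral_eq_integral) auto
      finally show ?thesis
        using that by (simp add: measure_def set_lebesgue_integral_def integral_nonneg_AE)
    qed
    \<comment> \<open>Two integrable functions with equal integrals over every measurable set agree
      almost everywhere.\<close>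
    show "AE z in circle_haar. h z = a * Re z + b * Im z"
    proof (rule density_unique_real)
      show "integrable circle_haar h"
        unfolding h_def using fi gi by simp
      show "integrable circle_haar (\<lambda>z. a * Re z + b * Im z)"
        using integrable_Re[OF integrable_haar_power[of 1]] integrable_Im[OF integrable_haar_power[of 1]] by simp
      fix A assume A: "A \<in> sets circle_haar"
      have "(\<integral>z\<in>A. h z \<partial>circle_haar) = (\<integral>z\<in>A. f z \<partial>circle_haar) - (\<integral>z\<in>A. g z \<partial>circle_haar)"
        unfolding h_def using A fi gi
        by (intro set_integral_diff) (auto simp: set_integrable_def intro: integrable_mult_indicator[where 'b = real, simplified])
      also have "\<dots> = measure \<mu> A - measure \<nu> A"
        using m[OF fi nn(1) A] m[OF gi nn(2) A] f g by simp
      finally show "(\<integral>z\<in>A. h z \<partial>circle_haar) = (\<integral>z\<in>A. (a * Re z + b * Im z) \<partial>circle_haar)"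
        using ab A by (simp add: sets_circle_haar)
    qed
  qed
  then show ?thesis
    unfolding energy dist using log_form_le[OF hm h2] by auto
qed

end
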